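(* Let $\mathcal{H}$ be a separable Hilbert space. A $k$-tuple of commuting operators $(C_1,\ldots,C_k)\in B(\mathcal{H})^k$ is jointly similar to a $k$-tuple of commuting isometries $(V_1,\ldots,V_k)\in B(\mathcal{H})^k$ if and only if there are constants $0<c\leq d$ such that $$c\|h\|^2\leq\|C_1^{s_1}\cdots C_k^{s_k}h\|^2\leq d\|h\|^2,\qquad h\in\mathcal{H},$$ for any $s_1,\ldots,s_k\in\mathbb{Z}_+$. Moreover, in this case there is an invertible operator $\xi:\mathcal{H}\to\mathcal{H}$, belonging to the von Neumann algebra generated by $C_1,\ldots,C_k$ and the identity, such that the operators $V_i=\xi C_i\xi^{-1}$, $i\in\{1,\ldots,k\}$, are commuting isometries.
   Context: $\mathbb{Z}_+=\{0,1,2,\ldots\}$. $(C_1,\ldots,C_k)$ is jointly similar to $(V_1,\ldots,V_k)$ if there is a single invertible operator $Y\in B(\mathcal{H})$ with $C_i=YV_iY^{-1}$ for all $i$. *)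

theory Defs
  imports "HOL-Analysis.Analysis"
begin

text \<open>
  Complex Hilbert spaces. The real inner product and the norm of the parent classes are the
  ones coming from the complex inner product: \<open>inner x y = Re (cinner x y)\<close>, hence
  \<open>(norm x)\<^sup>2 = cinner x x\<close>. The inner product is linear in its first argument.
\<close>

class chilbert_space = real_inner + banach +
  fixes scaleC :: "complex \<Rightarrow> 'a \<Rightarrow> 'a" (infixr \<open>*\<^sub>C\<close> 75)
    and cinner :: "'a \<Rightarrow> 'a \<Rightarrow> complex"
  assumes scaleC_add_right: "a *\<^sub>C (x + y) = a *\<^sub>C x + a *\<^sub>C y"
    and scaleC_add_left: "(a + b) *\<^sub>C x = a *\<^sub>C x + b *\<^sub>C x"
    and scaleC_scaleC: "a *\<^sub>C (b *\<^sub>C x) = (a * b) *\<^sub>C x"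
    and scaleC_one: "1 *\<^sub>C x = x"
    and scaleR_scaleC: "r *\<^sub>R x = complex_of_real r *\<^sub>C x"
    and cinner_commute: "cinner x y = cnj (cinner y x)"
    and cinner_add_left: "cinner (x + y) z = cinner x z + cinner y z"
    and cinner_scaleC_left: "cinner (a *\<^sub>C x) y = a * cinner x y"
    and inner_eq_Re_cinner: "inner x y = Re (cinner x y)"

text \<open>Elements of \<open>B(H)\<close> are functions satisfying \<open>bounded_clinear\<close>.\<close>

definition bounded_clinear :: "('h::chilbert_space \<Rightarrow> 'h) \<Rightarrow> bool" where
  "bounded_clinear T \<longleftrightarrow> bounded_linear T \<and> (\<forall>a x. T (a *\<^sub>C x) = a *\<^sub>C T x)"

definition invertible_op :: "('h::chilbert_space \<Rightarrow> 'h) \<Rightarrow> bool" where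
  "invertible_op T \<longleftrightarrow>
    bounded_clinear T \<and> (\<exists>S. bounded_clinear S \<and> S \<circ> T = id \<and> T \<circ> S = id)"

definition isometry_op :: "('h::chilbert_space \<Rightarrow> 'h) \<Rightarrow> bool" where
  "isometry_op T \<longleftrightarrow> bounded_clinear T \<and> (\<forall>h. norm (T h) = norm h)"

text \<open>
  A \<open>k\<close>-tuple of operators is a family \<open>C\<close> of which only the entries
  \<open>C 1, \<dots>, C k\<close> are relevant.
\<close>

definition commuting_tuple :: "nat \<Rightarrow> (nat \<Rightarrow> 'h::chilbert_space \<Rightarrow> 'h) \<Rightarrow> bool" where
  "commuting_tuple k C \<longleftrightarrow>
    (\<forall>i\<in>{1..k}. bounded_clinear (C i)) \<and>
    (\<forall>i\<in>{1..k}. \<forall>j\<in>{1..k}. C i \<circ> C j = C j \<circ> C i)"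

definition commuting_isometries :: "nat \<Rightarrow> (nat \<Rightarrow> 'h::chilbert_space \<Rightarrow> 'h) \<Rightarrow> bool" where
  "commuting_isometries k V \<longleftrightarrow> commuting_tuple k V \<and> (\<forall>i\<in>{1..k}. isometry_op (V i))"

definition jointly_similar ::
  "nat \<Rightarrow> (nat \<Rightarrow> 'h::chilbert_space \<Rightarrow> 'h) \<Rightarrow> (nat \<Rightarrow> 'h \<Rightarrow> 'h) \<Rightarrow> bool" where
  "jointly_similar k C V \<longleftrightarrow>
    (\<exists>Y. invertible_op Y \<and> (\<forall>i\<in>{1..k}. C i = Y \<circ> V i \<circ> inv Y))"

text \<open>\<open>op_monomial C s k\<close> is the product \<open>C\<^sub>1\<^bsup>s\<^sub>1\<^esup> \<cdots> C\<^sub>k\<^bsup>s\<^sub>k\<^esup>\<close>, in this order.\<close>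

primrec op_monomial :: "(nat \<Rightarrow> 'a \<Rightarrow> 'a) \<Rightarrow> (nat \<Rightarrow> nat) \<Rightarrow> nat \<Rightarrow> 'a \<Rightarrow> 'a" where
  "op_monomial C s 0 = id"
| "op_monomial C s (Suc k) = op_monomial C s k \<circ> (C (Suc k) ^^ s (Suc k))"

text \<open>Every bounded operator on a Hilbert space has exactly one adjoint (Riesz).\<close>

definition cadjoint :: "('h::chilbert_space \<Rightarrow> 'h) \<Rightarrow> 'h \<Rightarrow> 'h" where
  "cadjoint T = (THE S. \<forall>x y. cinner (T x) y = cinner x (S y))"

text \<open>
  The weak operator topology on \<open>B(H)\<close>, i.e. the initial topology for the maps
  \<open>T \<mapsto> cinner (T x) y\<close>: the function type \<open>'h \<times> 'h \<Rightarrow> complex\<close> carries the topology of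
  pointwise convergence.
\<close>

definition weak_operator_topology :: "('h::chilbert_space \<Rightarrow> 'h) topology" where
  "weak_operator_topology =
    pullback_topology {T. bounded_clinear T}
      (\<lambda>T (x, y). cinner (T x) y) (euclidean :: ('h \<times> 'h \<Rightarrow> complex) topology)"

definition von_neumann_algebra :: "('h::chilbert_space \<Rightarrow> 'h) set \<Rightarrow> bool" where
  "von_neumann_algebra M \<longleftrightarrow>
    M \<subseteq> {T. bounded_clinear T} \<and>
    id \<in> M \<and>
    (\<forall>S\<in>M. \<forall>T\<in>M. (\<lambda>x. S x + T x) \<in> M) \<and>
    (\<forall>a. \<forall>T\<in>M. (\<lambda>x. a *\<^sub>C T x) \<in> M) \<and>
    (\<forall>S\<in>M. \<forall>T\<in>M. S \<circ> T \<in> M) \<and>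
    (\<forall>T\<in>M. cadjoint T \<in> M) \<and>
    closedin weak_operator_topology M"

definition von_neumann_generated :: "('h::chilbert_space \<Rightarrow> 'h) set \<Rightarrow> ('h \<Rightarrow> 'h) set" where
  "von_neumann_generated G = \<Inter>{M. von_neumann_algebra M \<and> G \<subseteq> M}"

end

theory Submission
  imports Defs
begin

text \<open>
  If the monomials in the commuting operators \<open>C i\<close> are uniformly bounded above and below, a cluster
  point (in the weak operator topology) of Cesaro means of \<open>(C i)\<^sup>*\<^sup>n P (C i)\<^sup>n\<close> replaces a
  positive operator \<open>P\<close> by one with \<open>(C i)\<^sup>* P (C i) = P\<close>, keeping the invariance under the other
  operators and the bounds. Starting from the identity, this yields \<open>P\<close> with \<open>c \<le> P \<le> d\<close> in the
  generated von Neumann algebra that is invariant under every \<open>C i\<close>. The square root \<open>\<xi>\<close>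
  of \<open>P / d\<close> is invertible, lies in the same algebra, and \<open>norm (\<xi> (C i h)) = norm (\<xi> h)\<close>; so conjugation by
  \<open>\<xi>\<close> turns the \<open>C i\<close> into isometries.
\<close>

section \<open>Operators and sesquilinear forms\<close>

lemma cinner_add_right: "cinner x (y + z) = cinner x y + cinner (x :: 'h::chilbert_space) z"
  by (metis cinner_commute cinner_add_left complex_cnj_add)

lemma cinner_scaleC_right: "cinner x (a *\<^sub>C y) = cnj a * cinner (x :: 'h::chilbert_space) y"
  by (metis cinner_commute cinner_scaleC_left complex_cnj_mult)

lemma norm_scaleC: "norm (a *\<^sub>C x) = cmod a * norm (x :: 'h::chilbert_space)"
proof -
  have "(norm (a *\<^sub>C x))\<^sup>2 = (cmod a * norm x)\<^sup>2"
  proof -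
    have "cinner (a *\<^sub>C x) (a *\<^sub>C x) = complex_of_real ((cmod a)\<^sup>2) * cinner x x"
      unfolding complex_norm_square by (simp add: cinner_scaleC_left cinner_scaleC_right)
    then have "Re (cinner (a *\<^sub>C x) (a *\<^sub>C x)) = (cmod a)\<^sup>2 * Re (cinner x x)"
      by simp
    then show ?thesis
      by (simp only: power2_norm_eq_inner power_mult_distrib inner_eq_Re_cinner)
  qed
  then show ?thesis
    by (simp add: power2_eq_iff_nonneg)
qed

lemma norm_cinner_le: "cmod (cinner x y) \<le> norm x * norm (y :: 'h::chilbert_space)"
proof -
  \<comment> \<open>\<open>a\<close> is a phase with \<open>a * cinner x y\<close> equal to the
    modulus of \<open>cinner x y\<close>; absorbing it into the first argument reduces the claim to
    the real Cauchy-Schwarz inequality. If \<open>cinner x y = 0\<close>, then \<open>a = 0\<close>,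
    which is harmless.\<close>
  define a where "a = cnj (sgn (cinner x y))"
  have "a * cinner x y = cmod (cinner x y)"
    using complex_norm_square[of "cinner x y"]
    by (cases "cinner x y = 0") (simp_all add: a_def sgn_eq field_simps power2_eq_square)
  then have "cmod (cinner x y) = inner (a *\<^sub>C x) y"
    by (simp add: inner_eq_Re_cinner cinner_scaleC_left)
  also have "\<dots> \<le> norm (a *\<^sub>C x) * norm y"
    by (rule norm_cauchy_schwarz)
  also have "\<dots> \<le> norm x * norm y"
    by (simp add: norm_scaleC a_def norm_sgn)
  finally show ?thesis .
qed

lemma bounded_bilinear_cinner: "bounded_bilinear (cinner :: 'h::chilbert_space \<Rightarrow> 'h \<Rightarrow> complex)"
proof
  show "\<exists>K. \<forall>a b :: 'h. cmod (cinner a b) \<le> norm a * norm b * K"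
    using norm_cinner_le by (metis mult.right_neutral)
qed (simp_all add: cinner_add_left cinner_add_right scaleR_scaleC cinner_scaleC_left
    cinner_scaleC_right scaleR_conv_of_real)

interpretation cinner: bounded_bilinear "cinner :: 'h::chilbert_space \<Rightarrow> 'h \<Rightarrow> complex"
  by (rule bounded_bilinear_cinner)

lemma inner_ext:
  assumes "\<And>z. inner z x = inner z (y :: 'a::real_inner)"
  shows "x = y"
  using assms[of "x - y"] by (metis inner_diff_right inner_eq_zero_iff right_minus_eq)

lemma cinner_ext:
  assumes "\<And>z. cinner x z = cinner y (z :: 'h::chilbert_space)"
  shows "x = y"
  by (rule inner_ext) (metis assms cinner_commute inner_eq_Re_cinner)

lemma bounded_clinear_linear:
  assumes "bounded_clinear T"
  shows "T (x + y) = T x + T y" "T (x - y) = T x - T y" "T (a *\<^sub>C x) = a *\<^sub>C T x"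
    "T (r *\<^sub>R x) = r *\<^sub>R T x"
  using assms by (simp_all add: bounded_clinear_def bounded_linear.linear linear_add linear_diff
      linear_scale)

lemma bounded_clinearI:
  fixes T :: "'h::chilbert_space \<Rightarrow> 'h"
  assumes "\<And>x y. T (x + y) = T x + T y" "\<And>a x. T (a *\<^sub>C x) = a *\<^sub>C T x"
    and "\<And>x. norm (T x) \<le> norm x * K"
  shows "bounded_clinear T"
  using assms unfolding bounded_clinear_def
  by (auto intro!: bounded_linear_intro simp: scaleR_scaleC)

lemma bounded_clinear_id: "bounded_clinear id"
  by (rule bounded_clinearI[where K = 1]) auto

lemma bounded_clinear_compose:
  "bounded_clinear S \<Longrightarrow> bounded_clinear T \<Longrightarrow> bounded_clinear (S \<circ> T)"
  by (auto simp: bounded_clinear_def o_def intro: bounded_linear_compose)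

lemma bounded_clinear_add:
  "bounded_clinear S \<Longrightarrow> bounded_clinear T \<Longrightarrow> bounded_clinear (\<lambda>x. S x + T x)"
  by (auto simp: bounded_clinear_def scaleC_add_right intro: bounded_linear_add)

lemma bounded_clinear_scaleC:
  assumes "bounded_clinear T"
  shows "bounded_clinear (\<lambda>x. a *\<^sub>C T x)"
proof -
  obtain K where "\<And>x. norm (T x) \<le> norm x * K"
    using assms bounded_linear.bounded[of T] by (auto simp: bounded_clinear_def)
  then have "norm (a *\<^sub>C T x) \<le> norm x * (cmod a * K)" for x
    using mult_left_mono[of "norm (T x)" "norm x * K" "cmod a"] by (simp add: norm_scaleC mult_ac)
  then show ?thesis
    by (rule bounded_clinearI[rotated 2])
      (simp_all add: bounded_clinear_linear[OF assms] scaleC_add_right scaleC_scaleC mult.commute)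
qed

lemma bounded_clinear_bound:
  assumes "bounded_clinear T"
  obtains K where "0 < K" "\<And>x. norm (T x) \<le> K * norm x"
  using assms bounded_linear.pos_bounded[of T] by (auto simp: bounded_clinear_def mult.commute)

text \<open>The representing vector minimises \<open>(norm x)\<^sup>2 - 2 * f x\<close>.\<close>

lemma riesz_representation:
  fixes f :: "'h::{real_inner, banach} \<Rightarrow> real"
  assumes "bounded_linear f"
  obtains u where "\<And>x. f x = inner x u"
proof -
  interpret f: bounded_linear f by fact
  obtain K where K: "\<And>x. \<bar>f x\<bar> \<le> norm x * K"
    using f.bounded by auto
  define \<phi> where "\<phi> x = (norm x)\<^sup>2 - 2 * f x" for x
  define m where "m = Inf (range \<phi>)"
  have "\<phi> x \<ge> - K\<^sup>2" for x
  proof -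
    have "0 \<le> (norm x - K)\<^sup>2"
      by simp
    then show ?thesis
      using K[of x] by (simp add: \<phi>_def power2_diff algebra_simps)
  qed
  then have bdd: "bdd_below (range \<phi>)"
    by (intro bdd_belowI[of _ "- K\<^sup>2"]) blast
  then have m_le: "m \<le> \<phi> x" for x
    by (simp add: m_def cInf_lower)
  have "\<exists>x. \<phi> x < m + 1 / Suc n" for n
    using cInf_lessD[of "range \<phi>" "m + 1 / Suc n"] by (auto simp: m_def)
  then obtain x where x: "\<And>n. \<phi> (x n) < m + 1 / Suc n"
    by metis
  \<comment> \<open>The contributions of \<open>f\<close> cancel, so this is the parallelogram law
    written in terms of \<open>\<phi>\<close>. Bounding the value at the midpoint below by
    \<open>m\<close> makes a minimising sequence Cauchy.\<close>
  have parallelogram: "(norm (y - z))\<^sup>2 = 2 * \<phi> y + 2 * \<phi> z - 4 * \<phi> ((1/2) *\<^sub>R (y + z))" for y z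
    by (simp add: \<phi>_def f.add f.scaleR power2_norm_eq_inner inner_add_left inner_add_right
        inner_diff_left inner_diff_right inner_commute algebra_simps)
  have dist_le: "(dist (x i) (x j))\<^sup>2 \<le> 2 / Suc i + 2 / Suc j" for i j
    using parallelogram[of "x i" "x j"] x[of i] x[of j] m_le[of "(1/2) *\<^sub>R (x i + x j)"]
    by (simp add: dist_norm)
  have "Cauchy x"
  proof (rule metric_CauchyI)
    fix e :: real assume "0 < e"
    then obtain N where N: "4 / e\<^sup>2 < real N"
      using reals_Archimedean2 by blast
    have "dist (x i) (x j) < e" if "N \<le> i" "N \<le> j" for i j
    proof (rule power_less_imp_less_base)
      have "real N > 0"
        using N \<open>0 < e\<close> by (smt (verit) divide_nonneg_nonneg zero_le_power2)
      have "2 / Suc i \<le> 2 / N" "2 / Suc j \<le> 2 / N"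
        using that \<open>real N > 0\<close> by (auto intro!: divide_left_mono)
      then have "(dist (x i) (x j))\<^sup>2 \<le> 4 / N"
        using dist_le[of i j] by simp
      also have "\<dots> < e\<^sup>2"
        using N \<open>0 < e\<close> \<open>real N > 0\<close> by (simp add: field_simps)
      finally show "(dist (x i) (x j))\<^sup>2 < e\<^sup>2" .
    qed (use \<open>0 < e\<close> in simp)
    then show "\<exists>M. \<forall>i\<ge>M. \<forall>j\<ge>M. dist (x i) (x j) < e"
      by blast
  qed
  then obtain u where u: "x \<longlonglongrightarrow> u"
    by (auto simp: Cauchy_convergent_iff convergent_def)
  have "(\<lambda>n. \<phi> (x n)) \<longlonglongrightarrow> \<phi> u"
    unfolding \<phi>_def by (intro tendsto_intros u f.tendsto)
  moreover have "(\<lambda>n. m + 1 / Suc n) \<longlonglongrightarrow> m + 0"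
    by (intro tendsto_intros LIMSEQ_Suc[OF lim_1_over_n])
  ultimately have "\<phi> u \<le> m"
    using x by (intro LIMSEQ_le[of "\<lambda>n. \<phi> (x n)"]) (auto intro: less_imp_le)
  have "f y = inner y u" for y
  proof -
    define b where "b = inner y u - f y"
    \<comment> \<open>First variation of \<open>\<phi>\<close> at the minimiser \<open>u\<close> in
      direction \<open>y\<close>. The choice \<open>t = - b / (norm y)\<^sup>2\<close> turns the
      right side into \<open>- (b\<^sup>2 / (norm y)\<^sup>2)\<close>, which forces
      \<open>b = 0\<close>.\<close>
    have quadratic: "0 \<le> t\<^sup>2 * (norm y)\<^sup>2 + 2 * t * b" for t
    proof -
      have "(norm (u + t *\<^sub>R y))\<^sup>2 = (norm u)\<^sup>2 + 2 * t * inner y u + t\<^sup>2 * (norm y)\<^sup>2"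
        unfolding power2_norm_eq_inner
        by (simp add: inner_add_left inner_add_right inner_commute power2_eq_square)
      then show ?thesis
        using m_le[of "u + t *\<^sub>R y"] \<open>\<phi> u \<le> m\<close>
        by (simp add: \<phi>_def b_def f.add f.scaleR algebra_simps)
    qed
    have "b = 0"
    proof (cases "y = 0")
      case False
      have *: "(- b / N)\<^sup>2 * N + 2 * (- b / N) * b = - (b\<^sup>2 / N)" if "N > 0" for N
        using that by (simp add: field_simps power2_eq_square)
      have "0 \<le> - (b\<^sup>2 / (norm y)\<^sup>2)"
        using quadratic[of "- b / (norm y)\<^sup>2"] False by (subst (asm) *) auto
      then have "b\<^sup>2 \<le> 0"
        using False by (simp add: divide_le_0_iff)
      then show ?thesis by simp
    qed (simp add: b_def f.zero)
    then show ?thesis by (simp add: b_def)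
  qed
  then show thesis
    using that by blast
qed

text \<open>For fixed \<open>x\<close>, the real part of \<open>g x\<close> is a bounded real
  functional, so the real Riesz theorem supplies \<open>Q x\<close>; linearity of \<open>Q\<close>
  is inherited from \<open>g\<close>. This produces both adjoints and the operators behind weak
  limits of forms.\<close>

lemma sesquilinear_form_operator:
  fixes g :: "'h::chilbert_space \<Rightarrow> 'h \<Rightarrow> complex"
  assumes add_left: "\<And>x y z. g (x + y) z = g x z + g y z"
    and scaleC_left: "\<And>a x y. g (a *\<^sub>C x) y = a * g x y"
    and add_right: "\<And>x y z. g x (y + z) = g x y + g x z"
    and scaleC_right: "\<And>a x y. g x (a *\<^sub>C y) = cnj a * g x y"
    and bound: "\<And>x y. cmod (g x y) \<le> K * norm x * norm y"
  obtains Q where "bounded_clinear Q" "\<And>x y. cinner (Q x) y = g x y"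
proof -
  have "\<exists>u. \<forall>y. Re (g x y) = inner y u" for x
  proof -
    have "bounded_linear (\<lambda>y. Re (g x y))"
      by (rule bounded_linear_intro[where K = "K * norm x"])
        (use bound[of x] abs_Re_le_cmod[of "g x _"] in
          \<open>auto simp: add_right scaleR_scaleC scaleC_right mult.commute intro: order_trans\<close>)
    then show ?thesis
      using riesz_representation by metis
  qed
  then obtain Q where Q: "\<And>x y. Re (g x y) = inner y (Q x)"
    by metis
  have form: "cinner (Q x) y = g x y" for x y
  proof (rule complex_eqI)
    show *: "Re (cinner (Q x) y) = Re (g x y)" for y
      by (simp add: Q inner_commute[of y] flip: inner_eq_Re_cinner)
    \<comment> \<open>Both sides are conjugate linear in the second argument, so replacing
      \<open>y\<close> by \<open>\<i> *\<^sub>C y\<close> turns imaginary parts into real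
      parts.\<close>
    show "Im (cinner (Q x) y) = Im (g x y)"
      using *[of "\<i> *\<^sub>C y"] by (simp add: scaleC_right cinner_scaleC_right)
  qed
  have "bounded_clinear Q"
  proof (rule bounded_clinearI[where K = K])
    show "Q (x + y) = Q x + Q y" for x y
      by (rule cinner_ext) (simp add: form cinner_add_left add_left)
    show "Q (a *\<^sub>C x) = a *\<^sub>C Q x" for a x
      by (rule cinner_ext) (simp add: form cinner_scaleC_left scaleC_left)
    show "norm (Q x) \<le> norm x * K" for x
    proof (cases "Q x = 0")
      case True
      \<comment> \<open>No sign of \<open>K\<close> is assumed; the bound at the pair
        \<open>x\<close>, \<open>x\<close> shows that \<open>K\<close> is nonnegative unless
        \<open>x = 0\<close>.\<close>
      have "0 \<le> norm x * K * norm x"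
        using order_trans[OF norm_ge_zero bound[of x x]] by (simp add: mult_ac)
      with True show ?thesis
        by (cases "x = 0") (auto simp: zero_le_mult_iff)
    next
      case False
      have "norm (Q x) * norm (Q x) = Re (g x (Q x))"
        by (simp add: Q power2_norm_eq_inner flip: power2_eq_square)
      also have "\<dots> \<le> (norm x * K) * norm (Q x)"
        using bound[of x "Q x"] complex_Re_le_cmod[of "g x (Q x)"] by (simp add: mult_ac)
      finally show ?thesis
        using False by simp
    qed
  qed
  with form show thesis
    using that by blast
qed

text \<open>The form \<open>cinner x (T y)\<close> is represented by some \<open>S\<close>, and
  conjugate symmetry makes \<open>S\<close> an adjoint of \<open>T\<close>. Since an adjoint is
  determined by its inner products, the description in \<open>cadjoint\<close> denotes
  \<open>S\<close>.\<close>

lemma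
  assumes "bounded_clinear T"
  shows cinner_cadjoint: "cinner (T x) y = cinner x (cadjoint T y)"
    and bounded_clinear_cadjoint: "bounded_clinear (cadjoint T)"
proof -
  obtain K where K: "0 < K" "\<And>x. norm (T x) \<le> K * norm x"
    using bounded_clinear_bound[OF assms] by blast
  note lin = bounded_clinear_linear[OF assms]
  have "cmod (cinner x (T y)) \<le> K * norm x * norm y" for x y
    using norm_cinner_le[of x "T y"] mult_left_mono[OF K(2)[of y], of "norm x"]
    by (simp add: mult_ac)
  then obtain S where S: "bounded_clinear S" "\<And>x y. cinner (S x) y = cinner x (T y)"
    using sesquilinear_form_operator[of "\<lambda>x y. cinner x (T y)" K]
    by (auto simp: lin cinner_add_left cinner_add_right cinner_scaleC_left cinner_scaleC_right)
  have S': "cinner (T x) y = cinner x (S y)" for x y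
    by (metis S(2) cinner_commute)
  have "cadjoint T = S"
    unfolding cadjoint_def
  proof (rule the_equality)
    fix S' assume "\<forall>x y. cinner (T x) y = cinner x (S' y)"
    then show "S' = S"
      by (intro ext cinner_ext) (metis S(2) cinner_commute)
  qed (simp add: S')
  then show "cinner (T x) y = cinner x (cadjoint T y)" "bounded_clinear (cadjoint T)"
    using S S' by auto
qed

section \<open>Von Neumann algebras and weak limits\<close>

lemma
  assumes "von_neumann_algebra M"
  shows von_neumann_algebra_bounded: "T \<in> M \<Longrightarrow> bounded_clinear T"
    and von_neumann_algebra_id: "id \<in> M"
    and von_neumann_algebra_add: "S \<in> M \<Longrightarrow> T \<in> M \<Longrightarrow> (\<lambda>x. S x + T x) \<in> M"
    and von_neumann_algebra_scaleC: "T \<in> M \<Longrightarrow> (\<lambda>x. a *\<^sub>C T x) \<in> M"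
    and von_neumann_algebra_compose: "S \<in> M \<Longrightarrow> T \<in> M \<Longrightarrow> S \<circ> T \<in> M"
    and von_neumann_algebra_cadjoint: "T \<in> M \<Longrightarrow> cadjoint T \<in> M"
    and von_neumann_algebra_closedin: "closedin weak_operator_topology M"
  using assms unfolding von_neumann_algebra_def by blast+

lemma von_neumann_algebra_scaleR:
  "von_neumann_algebra M \<Longrightarrow> T \<in> M \<Longrightarrow> (\<lambda>x. r *\<^sub>R T x) \<in> M"
  by (simp add: scaleR_scaleC von_neumann_algebra_scaleC)

lemma von_neumann_algebra_diff:
  assumes "von_neumann_algebra M" "S \<in> M" "T \<in> M"
  shows "(\<lambda>x. S x - T x) \<in> M"
  using von_neumann_algebra_add[OF assms(1,2) von_neumann_algebra_scaleR[OF assms(1,3), of "- 1"]]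
  by simp

lemma von_neumann_algebra_funpow:
  "von_neumann_algebra M \<Longrightarrow> T \<in> M \<Longrightarrow> T ^^ n \<in> M"
  by (induction n) (auto intro: von_neumann_algebra_id von_neumann_algebra_compose)

lemma von_neumann_algebra_sum:
  assumes "von_neumann_algebra M" "\<And>i. i \<in> I \<Longrightarrow> T i \<in> M"
  shows "(\<lambda>x. \<Sum>i\<in>I. T i x) \<in> M"
proof -
  have zero: "(\<lambda>x. 0) \<in> M"
    using von_neumann_algebra_scaleR[OF assms(1) von_neumann_algebra_id[OF assms(1)], of 0] by simp
  show ?thesis
    using assms(2)
  proof (induction I rule: infinite_finite_induct)
    case (insert i I)
    then show ?case
      by (simp add: von_neumann_algebra_add[OF assms(1)])
  qed (simp_all add: zero)
qed

lemma topspace_weak_operator_topology: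
  "topspace weak_operator_topology = {T :: 'h::chilbert_space \<Rightarrow> 'h. bounded_clinear T}"
  by (auto simp: weak_operator_topology_def topspace_pullback_topology)

lemma von_neumann_algebra_bounded_operators:
  "von_neumann_algebra {T :: 'h::chilbert_space \<Rightarrow> 'h. bounded_clinear T}"
  using closedin_topspace[of "weak_operator_topology :: ('h \<Rightarrow> 'h) topology"]
  unfolding von_neumann_algebra_def topspace_weak_operator_topology
  by (simp add: bounded_clinear_id bounded_clinear_add bounded_clinear_scaleC
      bounded_clinear_compose bounded_clinear_cadjoint)

text \<open>Each closure property survives intersection. The algebra of all bounded operators
  contains \<open>G\<close>, so the intersected family is nonempty, as needed for weak closedness
  and for boundedness of the members.\<close>

lemma
  assumes "\<And>T. T \<in> G \<Longrightarrow> bounded_clinear T"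
  shows von_neumann_algebra_generated: "von_neumann_algebra (von_neumann_generated G)"
    and generators_subset: "G \<subseteq> von_neumann_generated G"
proof -
  let ?\<M> = "{M. von_neumann_algebra M \<and> G \<subseteq> M}"
  have ex: "{T. bounded_clinear T} \<in> ?\<M>"
    using assms von_neumann_algebra_bounded_operators by auto
  have "closedin weak_operator_topology (\<Inter>?\<M>)"
    using ex by (intro closedin_Inter) (auto intro: von_neumann_algebra_closedin)
  moreover have "\<Inter>?\<M> \<subseteq> {T. bounded_clinear T}"
    using ex by blast
  ultimately show "von_neumann_algebra (von_neumann_generated G)"
    unfolding von_neumann_generated_def von_neumann_algebra_def[of "\<Inter>?\<M>"]
    by (auto intro: von_neumann_algebra_id von_neumann_algebra_add von_neumann_algebra_scaleC
        von_neumann_algebra_compose von_neumann_algebra_cadjoint)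
  show "G \<subseteq> von_neumann_generated G"
    by (auto simp: von_neumann_generated_def)
qed

section \<open>Weak operator limits along filters\<close>

lemma tendsto_coordinatewise_iff:
  fixes f :: "'a \<Rightarrow> 'i \<Rightarrow> 'b::topological_space"
  shows "(f \<longlongrightarrow> l) F \<longleftrightarrow> (\<forall>i. ((\<lambda>x. f x i) \<longlongrightarrow> l i) F)"
  using limitin_componentwise[of "\<lambda>_. euclidean" UNIV f l F]
  by (simp add: euclidean_product_topology limitin_canonical_iff)

text \<open>The complement of \<open>M\<close> is the preimage of an open set of coefficient
  functions, and coefficient functions converge pointwise. If \<open>P\<close> were outside
  \<open>M\<close>, then eventually so would be the \<open>T i\<close>.\<close>

lemma von_neumann_algebra_weak_limit:
  assumes "von_neumann_algebra M" "F \<noteq> bot" "\<forall>\<^sub>F i in F. T i \<in> M" "bounded_clinear P"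
    and lim: "\<And>x y. ((\<lambda>i. cinner (T i x) y) \<longlongrightarrow> cinner (P x) y) F"
  shows "P \<in> M"
proof (rule ccontr)
  assume "P \<notin> M"
  let ?f = "\<lambda>T (x, y). cinner (T x) y"
  have "openin weak_operator_topology (topspace weak_operator_topology - M)"
    using von_neumann_algebra_closedin[OF assms(1)] by blast
  then obtain U where "open U"
    and U: "{T. bounded_clinear T} - M = ?f -` U \<inter> {T. bounded_clinear T}"
    unfolding topspace_weak_operator_topology unfolding weak_operator_topology_def
      openin_pullback_topology by auto
  have "((\<lambda>i. ?f (T i)) \<longlongrightarrow> ?f P) F"
    using lim by (auto simp: tendsto_coordinatewise_iff)
  moreover have "?f P \<in> U"
    using U \<open>P \<notin> M\<close> assms(4) by blast
  ultimately have "\<forall>\<^sub>F i in F. ?f (T i) \<in> U"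
    using \<open>open U\<close> by (auto dest: topological_tendstoD)
  with assms(3) have "\<forall>\<^sub>F i in F. False"
    by eventually_elim (use U von_neumann_algebra_bounded[OF assms(1)] in blast)
  with assms(2) show False
    by (simp add: trivial_limit_def)
qed

text \<open>A compact space, such as an uncountable product of discs, need not be sequentially
  compact. A filter finer than \<open>sequentially\<close> therefore takes the place of a convergent
  subsequence.\<close>

lemma compact_subnet_tendsto:
  fixes a :: "nat \<Rightarrow> 'a::topological_space"
  assumes "compact K" "\<And>n. a n \<in> K"
  obtains F l where "F \<noteq> bot" "F \<le> sequentially" "(a \<longlongrightarrow> l) F"
proof -
  have "filtermap a sequentially \<noteq> bot" "\<forall>\<^sub>F z in filtermap a sequentially. z \<in> K"
    using assms(2) by (simp_all add: filtermap_bot_iff eventually_filtermap)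
  then obtain l where l: "inf (nhds l) (filtermap a sequentially) \<noteq> bot"
    using assms(1) unfolding compact_filter by meson
  \<comment> \<open>The indices are restricted to large \<open>n\<close> with \<open>a n\<close>
    near the cluster point \<open>l\<close>. This filter is proper because every neighbourhood of
    \<open>l\<close> meets every tail of \<open>a\<close>.\<close>
  define F where "F = inf sequentially (filtercomap a (nhds l))"
  have "F \<noteq> bot"
  proof
    assume "F = bot"
    then have "\<forall>\<^sub>F n in F. False" by simp
    then obtain A B' where A: "eventually A sequentially"
      and "eventually B' (filtercomap a (nhds l))" and AB: "\<And>n. A n \<and> B' n \<Longrightarrow> False"
      unfolding F_def eventually_inf by metis
    then obtain B where B: "eventually B (nhds l)" "\<And>n. B (a n) \<Longrightarrow> B' n"
      unfolding eventually_filtercomap by metis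
    have "eventually (\<lambda>z. \<not> B z) (filtermap a sequentially)"
      unfolding eventually_filtermap using A by eventually_elim (use AB B(2) in metis)
    with B(1) have "eventually (\<lambda>_. False) (inf (nhds l) (filtermap a sequentially))"
      unfolding eventually_inf by metis
    with l show False
      by (simp add: trivial_limit_def)
  qed
  moreover have "F \<le> sequentially" "(a \<longlongrightarrow> l) F"
    by (auto simp: F_def filterlim_def filtermap_le_iff_le_filtercomap)
  ultimately show thesis
    using that by blast
qed

lemma compact_Pi_UNIV:
  fixes S :: "'i \<Rightarrow> 'b::topological_space set"
  assumes "\<And>i. compact (S i)"
  shows "compact (Pi UNIV S)"
  using compactin_PiE[of "\<lambda>_. euclidean" UNIV S] assms
  by (simp add: euclidean_product_topology PiE_UNIV_domain)

text \<open>The averaged forms are bounded by \<open>B x y\<close> uniformly in \<open>n\<close>, so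
  they lie in a product of closed discs, compact by Tychonoff. A cluster point is again a bounded
  sesquilinear form and gives \<open>Q\<close>; shifting the average by \<open>T\<close> changes it
  only by two boundary terms divided by \<open>Suc n\<close>.\<close>

lemma cesaro_mean_operator:
  assumes M: "von_neumann_algebra M" and "T \<in> M" "P \<in> M"
    and T: "\<And>n x. norm ((T ^^ n) x) \<le> K * norm x"
  obtains F Q where "F \<noteq> bot" "F \<le> sequentially" "Q \<in> M"
    "\<And>x y. ((\<lambda>n. (\<Sum>m\<le>n. cinner (P ((T ^^ m) x)) ((T ^^ m) y)) / of_nat (Suc n))
       \<longlongrightarrow> cinner (Q x) y) F"
    "\<And>x y. cinner (Q (T x)) (T y) = cinner (Q x) y"
proof -
  define a where "a n x y = (\<Sum>m\<le>n. cinner (P ((T ^^ m) x)) ((T ^^ m) y)) / of_nat (Suc n)"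
    for n x y
  \<comment> \<open>These operators realise the averaged forms inside \<open>M\<close>, which is
    what places the limit \<open>Q\<close> in \<open>M\<close>.\<close>
  define A where "A n x = (1 / real (Suc n)) *\<^sub>R (\<Sum>m\<le>n. (cadjoint (T ^^ m) \<circ> P \<circ> (T ^^ m)) x)"
    for n x
  have Tm: "T ^^ m \<in> M" for m
    using M \<open>T \<in> M\<close> by (rule von_neumann_algebra_funpow)
  have "A n \<in> M" for n
    unfolding A_def
    by (intro von_neumann_algebra_scaleR von_neumann_algebra_sum von_neumann_algebra_compose
        von_neumann_algebra_cadjoint M Tm \<open>P \<in> M\<close>)
  have lin: "bounded_clinear P" "bounded_clinear (T ^^ m)" for m
    using M \<open>P \<in> M\<close> Tm by (auto intro: von_neumann_algebra_bounded)
  have "cinner (cadjoint (T ^^ m) x) y = cinner x ((T ^^ m) y)" for m x y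
    by (metis lin(2) cinner_cadjoint cinner_commute)
  then have A: "cinner (A n x) y = a n x y" for n x y
    by (simp add: A_def a_def cinner.scaleR_left cinner.sum_left scaleR_conv_of_real)
  obtain L where "0 < L" and L: "\<And>x. norm (P x) \<le> L * norm x"
    using bounded_clinear_bound[OF lin(1)] by blast
  define B where "B x y = (L * (K * norm x)) * (K * norm y)" for x y :: 'a
  have term_bound: "cmod (cinner (P ((T ^^ m) x)) ((T ^^ m) y)) \<le> B x y" for m x y
  proof -
    have "norm (P ((T ^^ m) x)) \<le> L * (K * norm x)"
      using L[of "(T ^^ m) x"] mult_left_mono[OF T[of m x], of L] \<open>0 < L\<close> by linarith
    moreover have "0 \<le> K * norm x"
      using T[of m x] norm_ge_zero order_trans by blast
    ultimately show ?thesis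
      unfolding B_def using T[of m y] \<open>0 < L\<close>
      by (intro order_trans[OF norm_cinner_le] mult_mono) auto
  qed
  have a_bound: "cmod (a n x y) \<le> B x y" for n x y
  proof -
    have "cmod (\<Sum>m\<le>n. cinner (P ((T ^^ m) x)) ((T ^^ m) y)) \<le> (\<Sum>m\<le>n. B x y)"
      by (intro sum_norm_le term_bound)
    then show ?thesis
      by (simp add: a_def norm_divide field_simps del: of_nat_Suc)
  qed
  have "compact (Pi UNIV (\<lambda>(x, y). cball (0 :: complex) (B x y)))"
    by (rule compact_Pi_UNIV) auto
  moreover have "(\<lambda>(x, y). a n x y) \<in> Pi UNIV (\<lambda>(x, y). cball 0 (B x y))" for n
    using a_bound by auto
  ultimately obtain F l where F: "F \<noteq> bot" "F \<le> sequentially"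
    and l: "((\<lambda>n (x, y). a n x y) \<longlongrightarrow> l) F"
    using compact_subnet_tendsto[of _ "\<lambda>n (x, y). a n x y"] by blast
  define g where "g x y = l (x, y)" for x y
  have g: "((\<lambda>n. a n x y) \<longlongrightarrow> g x y) F" for x y
    using l[unfolded tendsto_coordinatewise_iff, rule_format, of "(x, y)"] by (simp add: g_def)
  \<comment> \<open>Every algebraic identity of the forms \<open>a n\<close> passes to
    \<open>g\<close> by uniqueness of limits along the proper filter \<open>F\<close>.\<close>
  note unique = tendsto_unique[OF F(1) g]
  obtain Q where Q: "bounded_clinear Q" "\<And>x y. cinner (Q x) y = g x y"
  proof (rule sesquilinear_form_operator[of g "L * K * K"])
    show "g (x + y) z = g x z + g y z" for x y z
      by (rule unique) (use tendsto_add[OF g[of x z] g[of y z]] in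
        \<open>simp add: cinner_add_left flip: A\<close>, simp add: A a_def lin bounded_clinear_linear
         cinner_add_left sum.distrib add_divide_distrib)
    show "g (b *\<^sub>C x) y = b * g x y" for b x y
      by (rule unique) (use tendsto_mult_left[OF g[of x y], of b] in
        \<open>simp add: a_def lin bounded_clinear_linear cinner_scaleC_left flip: sum_distrib_left\<close>)
    show "g z (x + y) = g z x + g z y" for x y z
      by (rule unique) (use tendsto_add[OF g[of z x] g[of z y]] in
        \<open>simp add: cinner_add_right flip: A\<close>)
    show "g x (b *\<^sub>C y) = cnj b * g x y" for b x y
      by (rule unique) (use tendsto_mult_left[OF g[of x y], of "cnj b"] in
        \<open>simp add: cinner_scaleC_right flip: A\<close>)
    show "cmod (g x y) \<le> L * K * K * norm x * norm y" for x y
      using tendsto_upperbound[OF tendsto_norm[OF g[of x y]] _ F(1), of "B x y"] a_bound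
      by (simp add: B_def mult_ac)
  qed blast
  have "Q \<in> M"
    using M F(1) _ Q(1) by (rule von_neumann_algebra_weak_limit[of _ _ A])
      (use \<open>\<And>n. A n \<in> M\<close> g in \<open>simp_all add: A Q\<close>)
  show thesis
  proof (rule that[OF F \<open>Q \<in> M\<close>])
    show "((\<lambda>n. (\<Sum>m\<le>n. cinner (P ((T ^^ m) x)) ((T ^^ m) y)) / of_nat (Suc n))
       \<longlongrightarrow> cinner (Q x) y) F" for x y
      using g[of x y] unfolding Q(2) a_def .
    show "cinner (Q (T x)) (T y) = cinner (Q x) y" for x y
    proof -
      \<comment> \<open>Replacing \<open>x\<close>, \<open>y\<close> by \<open>T x\<close>,
        \<open>T y\<close> shifts the index of \<open>b\<close> by one, so the difference of the two
        averages telescopes to \<open>b (Suc n) - b 0\<close>.\<close>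
      define b where "b m = cinner (P ((T ^^ m) x)) ((T ^^ m) y)" for m
      have "a n (T x) (T y) - a n x y = (b (Suc n) - b 0) / of_nat (Suc n)" for n
      proof -
        have "a n (T x) (T y) = (\<Sum>m\<le>n. b (Suc m)) / of_nat (Suc n)"
          by (simp add: a_def b_def funpow_swap1)
        moreover have "(\<Sum>m\<le>n. b (Suc m)) - (\<Sum>m\<le>n. b m) = b (Suc n) - b 0"
          by (induction n) (auto simp: algebra_simps)
        ultimately show ?thesis
          unfolding a_def b_def by (simp only: diff_divide_distrib[symmetric])
      qed
      moreover have "(\<lambda>n. (b (Suc n) - b 0) / of_nat (Suc n)) \<longlonglongrightarrow> 0"
      proof (rule Lim_null_comparison)
        have "cmod (b (Suc n) - b 0) \<le> 2 * B x y" for n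
          using norm_triangle_ineq4[of "b (Suc n)" "b 0"] term_bound[of "Suc n" x y]
            term_bound[of 0 x y] unfolding b_def by linarith
        then show "\<forall>\<^sub>F n in sequentially.
            cmod ((b (Suc n) - b 0) / of_nat (Suc n)) \<le> 2 * B x y * (1 / real (Suc n))"
          by (simp add: norm_divide divide_right_mono del: of_nat_Suc)
        show "(\<lambda>n. 2 * B x y * (1 / real (Suc n))) \<longlonglongrightarrow> 0"
          by (intro tendsto_mult_right_zero LIMSEQ_Suc[OF lim_1_over_n])
      qed
      \<comment> \<open>The difference tends to zero along \<open>sequentially\<close>, hence along
        the finer filter \<open>F\<close>.\<close>
      ultimately have "((\<lambda>n. a n (T x) (T y) - a n x y) \<longlongrightarrow> 0) F"
        by (simp only: tendsto_mono[OF F(2)])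
      with tendsto_diff[OF g[of "T x" "T y"] g[of x y]] have "g (T x) (T y) - g x y = 0"
        by (rule tendsto_unique[OF F(1)])
      then show ?thesis
        by (simp add: Q)
    qed
  qed
qed

section \<open>The invariant operator\<close>

lemma op_monomial_cong:
  "(\<And>i. i \<in> {1..k} \<Longrightarrow> s i = t i) \<Longrightarrow> op_monomial C s k = op_monomial C t k"
  by (induction k) auto

lemma op_monomial_zero: "op_monomial C (\<lambda>_. 0) k = id"
  by (induction k) auto

lemma funpow_comp_commute: "f \<circ> g = g \<circ> f \<Longrightarrow> f ^^ n \<circ> g = g \<circ> f ^^ n"
  by (induction n) (auto simp: fun_eq_iff)

lemma op_monomial_comp_commute:
  "(\<And>i. i \<in> {1..k} \<Longrightarrow> D \<circ> C i = C i \<circ> D) \<Longrightarrow> D \<circ> op_monomial C s k = op_monomial C s k \<circ> D"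
proof (induction k)
  case (Suc k)
  have "D \<circ> op_monomial C s k = op_monomial C s k \<circ> D"
    by (intro Suc.IH Suc.prems) simp
  moreover have "C (Suc k) ^^ s (Suc k) \<circ> D = D \<circ> C (Suc k) ^^ s (Suc k)"
    by (intro funpow_comp_commute Suc.prems[symmetric]) simp
  ultimately show ?case
    by (simp add: fun_eq_iff)
qed simp

lemma comp_op_monomial:
  assumes "commuting_tuple k C" "i \<in> {1..k}"
  shows "C i \<circ> op_monomial C s k = op_monomial C (s(i := Suc (s i))) k"
  using assms
proof (induction k)
  case (Suc k)
  show ?case
  proof (cases "i = Suc k")
    case True
    have "C i \<circ> op_monomial C s k = op_monomial C s k \<circ> C i"
      using Suc.prems by (intro op_monomial_comp_commute) (auto simp: commuting_tuple_def)
    moreover have "op_monomial C (s(i := Suc (s i))) k = op_monomial C s k"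
      using True by (intro op_monomial_cong) auto
    ultimately show ?thesis
      unfolding op_monomial.simps by (simp only: True comp_assoc[symmetric] fun_upd_same funpow.simps)
  next
    case False
    have *: "(s(i := Suc (s i))) (Suc k) = s (Suc k)"
      using False by simp
    from False have "C i \<circ> op_monomial C s k = op_monomial C (s(i := Suc (s i))) k"
      using Suc.prems by (intro Suc.IH) (auto simp: commuting_tuple_def)
    then show ?thesis
      unfolding op_monomial.simps by (simp only: * comp_assoc[symmetric])
  qed
qed simp

text \<open>Powers of a single \<open>C i\<close> act on monomials by shifting one exponent, so
  bounds assumed for all exponents remain available when averaging over \<open>C i\<close>.\<close>

lemma funpow_comp_op_monomial:
  assumes "commuting_tuple k C" "i \<in> {1..k}"
  shows "C i ^^ m \<circ> op_monomial C s k = op_monomial C (s(i := s i + m)) k"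
proof (induction m)
  case (Suc m)
  have "C i ^^ Suc m \<circ> op_monomial C s k = C i \<circ> op_monomial C (s(i := s i + m)) k"
    by (simp only: funpow.simps comp_assoc Suc.IH)
  also have "\<dots> = op_monomial C (s(i := s i + Suc m)) k"
    by (simp only: comp_op_monomial[OF assms] fun_upd_upd fun_upd_same add_Suc_right)
  finally show ?case .
qed simp

text \<open>The operators are averaged one at a time, starting from the identity. Commutativity
  ensures that averaging over the next operator does not destroy the invariance already
  obtained.\<close>

lemma exists_jointly_invariant_operator:
  assumes M: "von_neumann_algebra M" "\<And>i. i \<in> {1..k} \<Longrightarrow> C i \<in> M"
    and comm: "commuting_tuple k C"
    and lower: "\<And>s h. c * (norm h)\<^sup>2 \<le> (norm (op_monomial C s k h))\<^sup>2"
    and upper: "\<And>s h. (norm (op_monomial C s k h))\<^sup>2 \<le> d * (norm h)\<^sup>2"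
  obtains P where "P \<in> M" "\<And>x y. cinner (P x) y = cinner x (P y)"
    "\<And>h. c * (norm h)\<^sup>2 \<le> inner (P h) h" "\<And>h. inner (P h) h \<le> d * (norm h)\<^sup>2"
    "\<And>i x y. i \<in> {1..k} \<Longrightarrow> cinner (P (C i x)) (C i y) = cinner (P x) y"
proof -
  have power_bound: "norm ((C i ^^ m) x) \<le> sqrt d * norm x" if "i \<in> {1..k}" for i m x
  proof -
    \<comment> \<open>A power is the monomial with a single possibly nonzero exponent, so the upper
      bound makes all powers uniformly bounded, as the averaging requires.\<close>
    have "C i ^^ m = op_monomial C ((\<lambda>_. 0)(i := m)) k"
      using funpow_comp_op_monomial[OF comm that, of m "\<lambda>_. 0"] by (simp add: op_monomial_zero)
    then have "(norm ((C i ^^ m) x))\<^sup>2 \<le> d * (norm x)\<^sup>2"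
      using upper by simp
    then show ?thesis
      using real_le_rsqrt[of "norm ((C i ^^ m) x)" "d * (norm x)\<^sup>2"] by (simp add: real_sqrt_mult)
  qed
  text \<open>Averaging over \<open>C j\<close> preserves the bounds only if they are assumed along the whole
    semigroup, since the average involves \<open>P\<close> at all \<open>(C j ^^ m) h\<close>.\<close>
  define inv_upto where "inv_upto j P \<longleftrightarrow> (\<forall>x y. cinner (P x) y = cinner x (P y)) \<and>
      (\<forall>s h. inner (P (op_monomial C s k h)) (op_monomial C s k h)
        \<in> {c * (norm h)\<^sup>2..d * (norm h)\<^sup>2}) \<and>
      (\<forall>i\<in>{1..j}. \<forall>x y. cinner (P (C i x)) (C i y) = cinner (P x) y)" for j and P :: "'a \<Rightarrow> 'a"
  have "j \<le> k \<Longrightarrow> \<exists>P\<in>M. inv_upto j P" for j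
  proof (induction j)
    case 0
    have "inv_upto 0 id"
      using lower upper by (simp add: inv_upto_def power2_norm_eq_inner)
    then show ?case
      using von_neumann_algebra_id[OF M(1)] by blast
  next
    case (Suc j)
    then obtain P where "P \<in> M" and "inv_upto j P"
      by (meson Suc_leD)
    then have adj: "\<And>x y. cinner (P x) y = cinner x (P y)"
      and bounds: "\<And>s h. inner (P (op_monomial C s k h)) (op_monomial C s k h)
          \<in> {c * (norm h)\<^sup>2..d * (norm h)\<^sup>2}"
      and invariant: "\<And>i x y. i \<in> {1..j} \<Longrightarrow> cinner (P (C i x)) (C i y) = cinner (P x) y"
      unfolding inv_upto_def by blast+
    define T where "T = C (Suc j)"
    have j: "Suc j \<in> {1..k}" using Suc.prems by simp
    have T: "T \<in> M" "norm ((T ^^ m) x) \<le> sqrt d * norm x" for m x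
      using M(2)[OF j] power_bound[OF j] by (simp_all add: T_def)
    define a where "a n x y = (\<Sum>m\<le>n. cinner (P ((T ^^ m) x)) ((T ^^ m) y)) / of_nat (Suc n)"
      for n x y
    obtain F Q where F: "F \<noteq> bot" "F \<le> sequentially" and "Q \<in> M"
      and lim: "\<And>x y. ((\<lambda>n. a n x y) \<longlongrightarrow> cinner (Q x) y) F"
      and Q_inv: "\<And>x y. cinner (Q (T x)) (T y) = cinner (Q x) y"
      using cesaro_mean_operator[OF M(1) T(1) \<open>P \<in> M\<close> T(2), folded a_def] by blast
    have "cinner (Q x) y = cinner x (Q y)" for x y
    proof (rule tendsto_unique[OF F(1) lim])
      \<comment> \<open>Each averaged form is Hermitian because \<open>P\<close> is symmetric, and
        conjugation is continuous, so the limit form is Hermitian too.\<close>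
      have "cnj (cinner (P u) v) = cinner (P v) u" for u v
        by (metis adj cinner_commute)
      then have "cnj (a n y x) = a n x y" for n
        unfolding a_def complex_cnj_divide cnj_sum complex_cnj_of_nat by simp
      then show "((\<lambda>n. a n x y) \<longlongrightarrow> cinner x (Q y)) F"
        using tendsto_cnj[OF lim[of y x]] by (simp only: cinner_commute[of x "Q y", symmetric])
    qed
    moreover have "inner (Q (op_monomial C s k h)) (op_monomial C s k h)
        \<in> {c * (norm h)\<^sup>2..d * (norm h)\<^sup>2}" for s h
    proof -
      let ?w = "op_monomial C s k h"
      \<comment> \<open>Every term of the average evaluates \<open>P\<close> at another monomial
        applied to the same \<open>h\<close>; all terms, hence the average and its limit, lie in the
        same interval.\<close>
      have "(T ^^ m) ?w = op_monomial C (s(Suc j := s (Suc j) + m)) k h" for m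
        using funpow_comp_op_monomial[OF comm j] by (simp add: T_def fun_eq_iff)
      then have *: "Re (cinner (P ((T ^^ m) ?w)) ((T ^^ m) ?w)) \<in> {c * (norm h)\<^sup>2..d * (norm h)\<^sup>2}" for m
        using bounds by (simp flip: inner_eq_Re_cinner)
      have Re_a: "Re (a n ?w ?w) = (\<Sum>m\<le>n. Re (cinner (P ((T ^^ m) ?w)) ((T ^^ m) ?w))) / Suc n" for n
        unfolding a_def Re_divide_of_nat Re_sum ..
      have "Re (a n ?w ?w) \<in> {c * (norm h)\<^sup>2..d * (norm h)\<^sup>2}" for n
      proof -
        define r where "r m = Re (cinner (P ((T ^^ m) ?w)) ((T ^^ m) ?w))" for m
        have "(\<Sum>m\<le>n. r m) \<le> real (Suc n) * (d * (norm h)\<^sup>2)"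
          "real (Suc n) * (c * (norm h)\<^sup>2) \<le> (\<Sum>m\<le>n. r m)"
          using sum_bounded_above[of "{..n}" r "d * (norm h)\<^sup>2"]
            sum_bounded_below[of "{..n}" "c * (norm h)\<^sup>2" r] * by (simp_all add: r_def)
        then show ?thesis
          unfolding Re_a r_def[symmetric]
          by (simp add: pos_le_divide_eq pos_divide_le_eq mult.commute del: of_nat_Suc)
      qed
      then show ?thesis
        using tendsto_lowerbound[OF tendsto_Re[OF lim[of ?w ?w]] _ F(1)]
          tendsto_upperbound[OF tendsto_Re[OF lim[of ?w ?w]] _ F(1)]
        by (simp add: inner_eq_Re_cinner)
    qed
    moreover have "cinner (Q (C i x)) (C i y) = cinner (Q x) y" if "i \<in> {1..Suc j}" for i x y
    proof (cases "i = Suc j")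
      case True
      then show ?thesis
        using Q_inv by (simp add: T_def)
    next
      case False
      then have i: "i \<in> {1..j}" "i \<in> {1..k}"
        using that j by auto
      \<comment> \<open>Moving \<open>C i\<close> past the powers of \<open>T\<close> lets the
        invariance of \<open>P\<close> under \<open>C i\<close> act on each term of the
        average.\<close>
      have "T ^^ m \<circ> C i = C i \<circ> T ^^ m" for m
        using comm i j unfolding T_def commuting_tuple_def by (intro funpow_comp_commute) blast
      then have "(T ^^ m) (C i z) = C i ((T ^^ m) z)" for m z
        by (metis comp_apply)
      then have "a n (C i x) (C i y) = a n x y" for n
        by (simp only: a_def invariant[OF i(1)])
      then show ?thesis
        using tendsto_unique[OF F(1) lim[of "C i x" "C i y"]] lim[of x y] by simp
    qed
    ultimately have "inv_upto (Suc j) Q"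
      unfolding inv_upto_def by blast
    then show ?case
      using \<open>Q \<in> M\<close> by blast
  qed
  from this[of k] obtain P where "P \<in> M" and "inv_upto k P"
    by blast
  then have P: "P \<in> M" "\<And>x y. cinner (P x) y = cinner x (P y)"
    and bounds: "\<And>s h. inner (P (op_monomial C s k h)) (op_monomial C s k h)
        \<in> {c * (norm h)\<^sup>2..d * (norm h)\<^sup>2}"
    and invariant: "\<And>i x y. i \<in> {1..k} \<Longrightarrow> cinner (P (C i x)) (C i y) = cinner (P x) y"
    unfolding inv_upto_def by blast+
  \<comment> \<open>Zero exponents give the identity monomial, which turns the bounds along the
    semigroup into plain bounds on \<open>P\<close>.\<close>
  show thesis
    by (rule that[OF P _ _ invariant]) (use bounds[of "\<lambda>_. 0"] in \<open>simp_all add: op_monomial_zero\<close>)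
qed

section \<open>Square roots\<close>

text \<open>Polarisation turns bounds on the quadratic form into a bound on
  \<open>inner (B x) y\<close>. It supplies the operator norm estimate that the contraction for the
  square root needs.\<close>

lemma norm_le_of_quadratic_form_bound:
  fixes B :: "'a::real_inner \<Rightarrow> 'a"
  assumes "linear B" and sym: "\<And>x y. inner (B x) y = inner x (B y)"
    and nonneg: "\<And>x. 0 \<le> inner (B x) x" and bound: "\<And>x. inner (B x) x \<le> b * (norm x)\<^sup>2"
    and "0 \<le> b"
  shows "norm (B x) \<le> b * norm x"
proof (cases "x = 0 \<or> B x = 0")
  case True
  then show ?thesis
    using linear_0[OF \<open>linear B\<close>] \<open>0 \<le> b\<close> by auto
next
  case False
  have polar: "4 * inner (B x) y \<le> b * (norm x + norm y)\<^sup>2" for y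
  proof -
    have "4 * inner (B x) y = inner (B (x + y)) (x + y) - inner (B (x - y)) (x - y)"
      using sym[of y x] by (simp add: linear_add[OF assms(1)] linear_diff[OF assms(1)]
          inner_add_left inner_add_right inner_diff_left inner_diff_right inner_commute)
    also have "\<dots> \<le> b * (norm (x + y))\<^sup>2"
      using nonneg[of "x - y"] bound[of "x + y"] by linarith
    also have "\<dots> \<le> b * (norm x + norm y)\<^sup>2"
      using \<open>0 \<le> b\<close> by (intro mult_left_mono power_mono norm_triangle_ineq) auto
    finally show ?thesis .
  qed
  \<comment> \<open>Among the multiples of \<open>B x\<close> the one with the norm of
    \<open>x\<close> is taken, so that the right side of \<open>polar\<close> becomes
    \<open>4 * b * (norm x)\<^sup>2\<close>.\<close>
  define y where "y = (norm x / norm (B x)) *\<^sub>R B x"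
  have "norm y = norm x" "inner (B x) y = norm x * norm (B x)"
    using False by (simp_all add: y_def dot_square_norm power2_eq_square)
  with polar[of y] have "norm x * norm (B x) \<le> norm x * (b * norm x)"
    by (simp add: power2_eq_square algebra_simps)
  with False show ?thesis
    by simp
qed

text \<open>Solving \<open>x - X x = y\<close> means finding a fixed point of the contraction
  sending \<open>x\<close> to \<open>y + X x\<close>. The triangle inequality bounds the inverse by
  \<open>1 / (1 - b)\<close>.\<close>

lemma invertible_id_minus_contraction:
  fixes X :: "'h::chilbert_space \<Rightarrow> 'h"
  assumes X: "bounded_clinear X" and "0 \<le> b" "b < 1" and norm_X: "\<And>x. norm (X x) \<le> b * norm x"
  shows "invertible_op (\<lambda>x. x - X x)"
proof -
  note lin = bounded_clinear_linear[OF X]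
  let ?Z = "\<lambda>x. x - X x"
  have Z: "bounded_clinear ?Z"
    using von_neumann_algebra_diff[OF von_neumann_algebra_bounded_operators, of id X] X
      bounded_clinear_id by simp
  have "\<exists>!x. ?Z x = y" for y
  proof -
    have "\<exists>!x. y + X x = x"
      using norm_X by (intro banach_fix_type[OF assms(2,3)]) (simp add: dist_norm flip: lin(2))
    then show ?thesis
      by (metis add_diff_cancel_right' diff_add_cancel)
  qed
  then obtain S where S: "\<And>y. ?Z (S y) = y" "\<And>x y. ?Z x = y \<Longrightarrow> x = S y"
    by metis
  have "bounded_clinear S"
  proof (rule bounded_clinearI[where K = "1 / (1 - b)"])
    show "S (x + y) = S x + S y" for x y
      by (rule S(2)[symmetric]) (simp add: bounded_clinear_linear[OF Z] S(1))
    show "S (a *\<^sub>C x) = a *\<^sub>C S x" for a x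
      by (rule S(2)[symmetric]) (simp add: bounded_clinear_linear(3)[OF Z] S(1))
    show "norm (S x) \<le> norm x * (1 / (1 - b))" for x
    proof -
      have "norm (S x) \<le> norm x + b * norm (S x)"
        using norm_triangle_ineq[of x "X (S x)"] norm_X[of "S x"] S(1)[of x]
        by (metis add_left_mono diff_add_cancel order_trans)
      with \<open>b < 1\<close> show ?thesis
        by (simp add: field_simps)
    qed
  qed
  moreover have "S \<circ> ?Z = id" "?Z \<circ> S = id"
    using S by (auto simp: fun_eq_iff)
  ultimately show ?thesis
    using Z unfolding invertible_op_def by blast
qed

text \<open>With \<open>P = id - B\<close> the square root is \<open>id - X\<close>, where \<open>X\<close> is the fixed point of the
  contraction \<open>X \<mapsto> (B + X \<circ> X) / 2\<close>.\<close>

lemma positive_square_root: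
  assumes M: "von_neumann_algebra M" and "P \<in> M"
    and adj: "\<And>x y. cinner (P x) y = cinner x (P y)"
    and "0 < c" and lower: "\<And>h. c * (norm h)\<^sup>2 \<le> inner (P h) h"
    and upper: "\<And>h. inner (P h) h \<le> (norm h)\<^sup>2"
  obtains \<xi> where "\<xi> \<in> M" "invertible_op \<xi>" "\<And>x y. cinner (\<xi> x) y = cinner x (\<xi> y)"
    "\<And>x. \<xi> (\<xi> x) = P x"
proof -
  \<comment> \<open>The maximum keeps \<open>b\<close> nonnegative even on the zero space, where the
    hypotheses allow \<open>c > 1\<close>.\<close>
  define b where "b = max 0 (1 - c)"
  have b: "0 \<le> b" "b < 1"
    using \<open>0 < c\<close> by (auto simp: b_def)
  define B where "B x = x - P x" for x
  have "B \<in> M"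
    using von_neumann_algebra_diff[OF M von_neumann_algebra_id[OF M] \<open>P \<in> M\<close>]
    by (simp add: B_def[abs_def])
  then have B: "bounded_clinear B" "bounded_linear B"
    using von_neumann_algebra_bounded[OF M] by (auto simp: bounded_clinear_def)
  have B_adj: "cinner (B x) y = cinner x (B y)" for x y
    by (simp add: B_def cinner.diff_left cinner.diff_right adj)
  have B_norm: "norm (B x) \<le> b * norm x" for x
  proof (rule norm_le_of_quadratic_form_bound)
    show "inner (B x) y = inner x (B y)" for x y
      by (simp add: inner_eq_Re_cinner B_adj)
    show "0 \<le> inner (B x) x" for x
      using upper[of x] by (simp add: B_def inner_diff_left power2_norm_eq_inner)
    show "inner (B x) x \<le> b * (norm x)\<^sup>2" for x
    proof -
      have "inner (B x) x \<le> (1 - c) * (norm x)\<^sup>2"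
        using lower[of x] by (simp add: B_def inner_diff_left power2_norm_eq_inner algebra_simps)
      also have "\<dots> \<le> b * (norm x)\<^sup>2"
        by (intro mult_right_mono) (auto simp: b_def)
      finally show ?thesis .
    qed
  qed (use B(2) b(1) in \<open>auto simp: bounded_linear.linear\<close>)
  define BL where "BL = Blinfun B"
  have BL: "blinfun_apply BL = B"
    using B(2) by (simp add: BL_def bounded_linear_Blinfun_apply)
  have "norm BL \<le> b"
    using b(1) B_norm by (intro norm_blinfun_bound) (auto simp: BL)
  \<comment> \<open>The fixed point is sought among symmetric elements of \<open>M\<close> in a ball
    of the operator norm. Values of type \<open>blinfun\<close> are only real linear; membership in
    \<open>M\<close> adds complex linearity.\<close>
  define S where "S = {X. blinfun_apply X \<in> M \<and>
    (\<forall>x y. cinner (blinfun_apply X x) y = cinner x (blinfun_apply X y)) \<and> norm X \<le> b}"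
  have "closed S"
    unfolding closed_sequential_limits
  proof (intro allI impI, elim conjE)
    fix X L assume X: "\<forall>n. X n \<in> S" and "X \<longlonglongrightarrow> L"
    have lim: "(\<lambda>n. blinfun_apply (X n) x) \<longlonglongrightarrow> blinfun_apply L x" for x
      using \<open>X \<longlonglongrightarrow> L\<close> by (intro blinfun.tendsto tendsto_const)
    \<comment> \<open>Complex linearity of the limit must be proved before the weak limit lemma can
      place \<open>L\<close> in \<open>M\<close>.\<close>
    have "blinfun_apply L (a *\<^sub>C x) = a *\<^sub>C blinfun_apply L x" for a x
    proof (rule cinner_ext)
      fix z
      have "blinfun_apply (X n) (a *\<^sub>C x) = a *\<^sub>C blinfun_apply (X n) x" for n
        using X von_neumann_algebra_bounded[OF M, THEN bounded_clinear_linear(3)]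
        by (auto simp: S_def)
      then have "(\<lambda>n. cinner (blinfun_apply (X n) (a *\<^sub>C x)) z) \<longlonglongrightarrow> cinner (a *\<^sub>C blinfun_apply L x) z"
        by (auto simp: cinner_scaleC_left intro!: tendsto_mult_left cinner.tendsto lim)
      moreover have "(\<lambda>n. cinner (blinfun_apply (X n) (a *\<^sub>C x)) z)
          \<longlonglongrightarrow> cinner (blinfun_apply L (a *\<^sub>C x)) z"
        by (intro cinner.tendsto lim tendsto_const)
      ultimately show "cinner (blinfun_apply L (a *\<^sub>C x)) z = cinner (a *\<^sub>C blinfun_apply L x) z"
        using LIMSEQ_unique by blast
    qed
    then have "bounded_clinear (blinfun_apply L)"
      by (simp add: bounded_clinear_def blinfun.bounded_linear_right)
    then have "blinfun_apply L \<in> M"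
      using X by (intro von_neumann_algebra_weak_limit[OF M sequentially_bot, of "\<lambda>n. blinfun_apply (X n)"]
          cinner.tendsto lim tendsto_const) (auto simp: S_def)
    moreover have "cinner (blinfun_apply L x) y = cinner x (blinfun_apply L y)" for x y
    proof (rule LIMSEQ_unique)
      show "(\<lambda>n. cinner (blinfun_apply (X n) x) y) \<longlonglongrightarrow> cinner (blinfun_apply L x) y"
        by (intro cinner.tendsto lim tendsto_const)
      have "cinner (blinfun_apply (X n) x) y = cinner x (blinfun_apply (X n) y)" for n
        using X by (auto simp: S_def)
      then show "(\<lambda>n. cinner (blinfun_apply (X n) x) y) \<longlonglongrightarrow> cinner x (blinfun_apply L y)"
        by (auto intro!: cinner.tendsto lim)
    qed
    moreover have "norm L \<le> b"
      using X by (intro tendsto_upperbound[OF tendsto_norm[OF \<open>X \<longlonglongrightarrow> L\<close>]]) (auto simp: S_def)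
    ultimately show "L \<in> S"
      by (simp add: S_def)
  qed
  then have "complete S"
    by (simp add: complete_eq_closed)
  define f where "f X = (1/2) *\<^sub>R (BL + (X o\<^sub>L X))" for X
  have f_apply: "blinfun_apply (f X) x = (1/2) *\<^sub>R (B x + X (X x))" for X x
    by (simp add: f_def blinfun.add_left blinfun.scaleR_left BL)
  have "\<exists>!X\<in>S. f X = X"
  proof (rule Banach_fix[OF \<open>complete S\<close> _ b])
    have "0 \<in> S"
      using von_neumann_algebra_sum[OF M, of "{}"] b(1)
      by (simp add: S_def zero_blinfun.rep_eq cinner.zero_left cinner.zero_right)
    then show "S \<noteq> {}" by auto
    show "f ` S \<subseteq> S"
    proof (rule image_subsetI)
      fix X assume X: "X \<in> S"
      have "blinfun_apply (f X) = (\<lambda>x. (1/2) *\<^sub>R (B x + (blinfun_apply X \<circ> blinfun_apply X) x))"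
        by (simp add: f_apply fun_eq_iff)
      also have "\<dots> \<in> M"
        using X by (intro von_neumann_algebra_scaleR von_neumann_algebra_add
            von_neumann_algebra_compose M \<open>B \<in> M\<close>) (auto simp: S_def)
      moreover have "norm (f X) \<le> b"
      proof -
        have "norm (X o\<^sub>L X) \<le> b * b"
          using X b(1) by (intro order_trans[OF norm_blinfun_compose] mult_mono) (auto simp: S_def)
        also have "\<dots> \<le> b"
          using b by (simp add: mult_left_le)
        finally show ?thesis
          using norm_triangle_ineq[of BL "X o\<^sub>L X"] \<open>norm BL \<le> b\<close> by (simp add: f_def)
      qed
      ultimately show "f X \<in> S"
        using X B_adj by (simp add: S_def f_apply cinner.scaleR_left cinner.scaleR_right
            cinner.add_left cinner.add_right)
    qed
    show "dist (f X) (f Y) \<le> b * dist X Y" if "X \<in> S" "Y \<in> S" for X Y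
    proof -
      \<comment> \<open>The splitting \<open>X\<^sup>2 - Y\<^sup>2 = X (X - Y) + (X - Y) Y\<close>
        avoids any commutation of \<open>X\<close> and \<open>Y\<close>; each summand costs a factor
        \<open>b\<close>, and the factor one half leaves \<open>b\<close> in total.\<close>
      have "f X - f Y = (1/2) *\<^sub>R ((X o\<^sub>L (X - Y)) + ((X - Y) o\<^sub>L Y))"
        by (rule blinfun_eqI) (simp add: f_apply blinfun.bilinear_simps scaleR_diff_right[symmetric])
      moreover have "norm (X o\<^sub>L (X - Y)) \<le> b * norm (X - Y)"
        using that by (intro order_trans[OF norm_blinfun_compose] mult_right_mono) (auto simp: S_def)
      moreover have "norm ((X - Y) o\<^sub>L Y) \<le> norm (X - Y) * b"
        using that by (intro order_trans[OF norm_blinfun_compose] mult_left_mono) (auto simp: S_def)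
      ultimately show ?thesis
        using norm_triangle_ineq[of "X o\<^sub>L (X - Y)" "(X - Y) o\<^sub>L Y"]
        by (simp add: dist_norm mult.commute[of _ b])
    qed
  qed
  then obtain X where "X \<in> S" and fX: "f X = X"
    by blast
  define \<xi> where "\<xi> x = x - blinfun_apply X x" for x
  have X: "blinfun_apply X \<in> M" "\<And>x y. cinner (X x) y = cinner x (X y)" "norm X \<le> b"
    using \<open>X \<in> S\<close> by (auto simp: S_def)
  have "norm (X x) \<le> b * norm x" for x
    using norm_blinfun[of X x] mult_right_mono[OF X(3) norm_ge_zero[of x]] by linarith
  then have "invertible_op \<xi>"
    unfolding \<xi>_def using invertible_id_minus_contraction[OF _ b]
      von_neumann_algebra_bounded[OF M X(1)] by blast
  moreover have "\<xi> \<in> M"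
    using von_neumann_algebra_diff[OF M von_neumann_algebra_id[OF M] X(1)]
    by (simp add: \<xi>_def[abs_def])
  moreover have "cinner (\<xi> x) y = cinner x (\<xi> y)" for x y
    by (simp add: \<xi>_def cinner.diff_left cinner.diff_right X(2))
  moreover have "\<xi> (\<xi> x) = P x" for x
  proof -
    \<comment> \<open>Expanding \<open>(id - X)\<^sup>2\<close> gives
      \<open>id - 2 X + X\<^sup>2\<close>, which this fixed point equation reduces to
      \<open>id - B = P\<close>.\<close>
    have "2 *\<^sub>R blinfun_apply X x = B x + X (X x)"
      using arg_cong[OF f_apply[of X x], of "(*\<^sub>R) 2"] by (simp add: fX)
    then show ?thesis
      by (simp add: \<xi>_def B_def blinfun.diff_right scaleR_2 algebra_simps)
  qed
  ultimately show thesis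
    using that by blast
qed

section \<open>Similarity to isometries\<close>

lemma invertible_op_inverse:
  assumes "invertible_op Y"
  shows "invertible_op (inv Y)" "bounded_clinear (inv Y)" "Y \<circ> inv Y = id" "inv Y \<circ> Y = id"
    "inv (inv Y) = Y"
proof -
  obtain S where S: "bounded_clinear S" "S \<circ> Y = id" "Y \<circ> S = id" and Y: "bounded_clinear Y"
    using assms by (auto simp: invertible_op_def)
  have "inv Y = S" "inv S = Y"
    using S inv_unique_comp by blast+
  then show "invertible_op (inv Y)" "bounded_clinear (inv Y)" "Y \<circ> inv Y = id" "inv Y \<circ> Y = id"
    "inv (inv Y) = Y"
    using S Y by (auto simp: invertible_op_def)
qed

lemma commuting_tuple_conj:
  assumes "commuting_tuple k C" "invertible_op Y"
  shows "commuting_tuple k (\<lambda>i. Y \<circ> C i \<circ> inv Y)"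
proof -
  note Y = invertible_op_inverse[OF assms(2)]
  have "(Y \<circ> C i \<circ> inv Y) \<circ> (Y \<circ> C j \<circ> inv Y) = Y \<circ> (C i \<circ> C j) \<circ> inv Y" for i j
    using Y(4) by (simp add: fun_eq_iff)
  moreover have "bounded_clinear (Y \<circ> C i \<circ> inv Y)" if "i \<in> {1..k}" for i
    using assms Y(2) that
    by (intro bounded_clinear_compose) (auto simp: commuting_tuple_def invertible_op_def)
  ultimately show ?thesis
    using assms(1) by (simp add: commuting_tuple_def)
qed

lemma op_monomial_conj:
  assumes "invertible_op Y" "\<And>i. i \<in> {1..k} \<Longrightarrow> C i = Y \<circ> V i \<circ> inv Y"
  shows "op_monomial C s k = Y \<circ> op_monomial V s k \<circ> inv Y"
  using assms(2)
proof (induction k)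
  case 0
  then show ?case
    using invertible_op_inverse(3)[OF assms(1)] by simp
next
  case (Suc k)
  note Y = invertible_op_inverse(3,4)[OF assms(1)]
  have "(Y \<circ> W \<circ> inv Y) ^^ n = Y \<circ> W ^^ n \<circ> inv Y" for W n
    using Y by (induction n) (auto simp: fun_eq_iff)
  then have "C (Suc k) ^^ s (Suc k) = Y \<circ> V (Suc k) ^^ s (Suc k) \<circ> inv Y"
    using Suc.prems[of "Suc k"] by (metis atLeastAtMost_iff le_add1 order_refl plus_1_eq_Suc)
  moreover have "op_monomial C s k = Y \<circ> op_monomial V s k \<circ> inv Y"
    using Suc.prems by (intro Suc.IH) auto
  ultimately show ?case
    using Y(2) by (simp add: fun_eq_iff)
qed

lemma norm_op_monomial_isometries:
  "commuting_isometries k V \<Longrightarrow> norm (op_monomial V s k h) = norm h"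
proof (induction k arbitrary: h)
  case (Suc k)
  then have V: "isometry_op (V (Suc k))" and "commuting_isometries k V"
    by (auto simp: commuting_isometries_def commuting_tuple_def)
  have "norm ((V (Suc k) ^^ n) h) = norm h" for n
    using V by (induction n) (auto simp: isometry_op_def)
  with Suc.IH[OF \<open>commuting_isometries k V\<close>] show ?case
    by simp
qed simp

text \<open>One conjugation by \<open>Y\<close> turns the whole monomial in \<open>C\<close> into an
  isometric monomial in \<open>V\<close>, so only the norms of \<open>Y\<close> and its inverse
  enter, independently of the exponents.\<close>

lemma similar_to_isometries_imp_bounds:
  assumes V: "commuting_isometries k V" and "jointly_similar k C V"
  obtains c d :: real where "0 < c" "c \<le> d"
    "\<And>s h. c * (norm h)\<^sup>2 \<le> (norm (op_monomial C s k h))\<^sup>2"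
    "\<And>s h. (norm (op_monomial C s k h))\<^sup>2 \<le> d * (norm h)\<^sup>2"
proof -
  obtain Y where Y: "invertible_op Y" and C: "\<And>i. i \<in> {1..k} \<Longrightarrow> C i = Y \<circ> V i \<circ> inv Y"
    using assms(2) by (auto simp: jointly_similar_def)
  note Yi = invertible_op_inverse[OF Y]
  obtain K where K: "0 < K" "\<And>x. norm (Y x) \<le> K * norm x"
    using Y bounded_clinear_bound by (metis invertible_op_def)
  obtain L where L: "0 < L" "\<And>x. norm (inv Y x) \<le> L * norm x"
    using bounded_clinear_bound[OF Yi(2)] by blast
  \<comment> \<open>Taking at least \<open>1\<close> guarantees
    \<open>1 / \<kappa>\<^sup>2 \<le> \<kappa>\<^sup>2\<close>, the order required of the two
    constants.\<close>
  define \<kappa> where "\<kappa> = max 1 (K * L)"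
  have \<kappa>: "1 \<le> \<kappa>" "K * L \<le> \<kappa>"
    by (auto simp: \<kappa>_def)
  have *: "norm h \<le> \<kappa> * norm (op_monomial C s k h)" "norm (op_monomial C s k h) \<le> \<kappa> * norm h"
    for s h
  proof -
    let ?w = "op_monomial V s k (inv Y h)"
    have w: "norm ?w = norm (inv Y h)"
      by (rule norm_op_monomial_isometries[OF V])
    have Cw: "op_monomial C s k h = Y ?w"
      using op_monomial_conj[of Y k C V s, OF Y C] by (simp only: o_apply)
    have "norm (Y ?w) \<le> K * (L * norm h)"
      using K(2)[of ?w] mult_left_mono[OF L(2)[of h], of K] K(1) unfolding w by linarith
    also have "\<dots> \<le> \<kappa> * norm h"
      using mult_right_mono[OF \<kappa>(2) norm_ge_zero[of h]] by (simp add: mult.assoc)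
    finally show "norm (op_monomial C s k h) \<le> \<kappa> * norm h"
      by (simp add: Cw)
    \<comment> \<open>For the lower bound, \<open>h\<close> is recovered as
      \<open>Y (inv Y h)\<close>, and the isometric monomial allows \<open>inv Y h\<close> to be
      replaced by \<open>?w = inv Y (Y ?w)\<close> inside the norm.\<close>
    have "norm h = norm (Y (inv Y h))"
      using Yi(3) by (simp add: fun_eq_iff)
    also have "\<dots> \<le> K * norm (inv Y (Y ?w))"
      using K(2)[of "inv Y h"] w Yi(4) by (simp add: fun_eq_iff)
    also have "\<dots> \<le> K * (L * norm (Y ?w))"
      using L(2)[of "Y ?w"] K(1) by (intro mult_left_mono) auto
    also have "\<dots> \<le> \<kappa> * norm (Y ?w)"
      using mult_right_mono[OF \<kappa>(2) norm_ge_zero[of "Y ?w"]] by (simp add: mult.assoc)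
    finally show "norm h \<le> \<kappa> * norm (op_monomial C s k h)"
      by (simp add: Cw)
  qed
  show thesis
  proof (rule that[of "1 / \<kappa>\<^sup>2" "\<kappa>\<^sup>2"])
    have "1 \<le> \<kappa>\<^sup>2"
      using \<kappa>(1) by (simp add: one_le_power)
    moreover from this have "1 / \<kappa>\<^sup>2 \<le> 1"
      by (intro divide_le_eq_1[THEN iffD2] disjI1) linarith
    ultimately show "0 < 1 / \<kappa>\<^sup>2" "1 / \<kappa>\<^sup>2 \<le> \<kappa>\<^sup>2"
      using \<kappa>(1) by (simp, linarith)
    show "1 / \<kappa>\<^sup>2 * (norm h)\<^sup>2 \<le> (norm (op_monomial C s k h))\<^sup>2" for s h
      using power_mono[OF *(1)[of h s], of 2] \<kappa>(1)
      by (simp add: divide_le_eq power_mult_distrib mult.commute)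
    show "(norm (op_monomial C s k h))\<^sup>2 \<le> \<kappa>\<^sup>2 * (norm h)\<^sup>2" for s h
      using power_mono[OF *(2)[of s h], of 2] by (simp add: power_mult_distrib)
  qed
qed

lemma bounds_imp_similar_to_isometries:
  assumes comm: "commuting_tuple k C" and "0 < c" "c \<le> d"
    and lower: "\<And>s h. c * (norm h)\<^sup>2 \<le> (norm (op_monomial C s k h))\<^sup>2"
    and upper: "\<And>s h. (norm (op_monomial C s k h))\<^sup>2 \<le> d * (norm h)\<^sup>2"
  obtains \<xi> where "invertible_op \<xi>" "\<xi> \<in> von_neumann_generated (insert id (C ` {1..k}))"
    "commuting_isometries k (\<lambda>i. \<xi> \<circ> C i \<circ> inv \<xi>)"
proof -
  define M where "M = von_neumann_generated (insert id (C ` {1..k}))"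
  have bdd: "bounded_clinear T" if "T \<in> insert id (C ` {1..k})" for T
    using that comm bounded_clinear_id by (auto simp: commuting_tuple_def)
  have M: "von_neumann_algebra M" and C_mem: "\<And>i. i \<in> {1..k} \<Longrightarrow> C i \<in> M"
    using von_neumann_algebra_generated[of "insert id (C ` {1..k})"]
      generators_subset[of "insert id (C ` {1..k})"] bdd unfolding M_def by blast+
  obtain P where "P \<in> M" and adj: "\<And>x y. cinner (P x) y = cinner x (P y)"
    and P: "\<And>h. c * (norm h)\<^sup>2 \<le> inner (P h) h" "\<And>h. inner (P h) h \<le> d * (norm h)\<^sup>2"
    and invariant: "\<And>i x y. i \<in> {1..k} \<Longrightarrow> cinner (P (C i x)) (C i y) = cinner (P x) y"
    by (rule exists_jointly_invariant_operator[OF M C_mem comm lower upper]) blast+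
  have "0 < d"
    using assms by simp
  \<comment> \<open>Division by \<open>d\<close> brings the operator below the identity, as the
    square root construction demands; the factor cancels when norms are compared.\<close>
  obtain \<xi> where \<xi>: "\<xi> \<in> M" "invertible_op \<xi>" "\<And>x y. cinner (\<xi> x) y = cinner x (\<xi> y)"
    "\<And>x. \<xi> (\<xi> x) = (1 / d) *\<^sub>R P x"
  proof (rule positive_square_root[OF M von_neumann_algebra_scaleR[OF M \<open>P \<in> M\<close>, of "1 / d"]])
    show "0 < c / d"
      using assms by simp
    show "c / d * (norm h)\<^sup>2 \<le> inner ((1 / d) *\<^sub>R P h) h"
      "inner ((1 / d) *\<^sub>R P h) h \<le> (norm h)\<^sup>2" for h
      using P[of h] \<open>0 < d\<close> by (auto simp: field_simps)
  qed (auto simp: adj cinner.scaleR_left cinner.scaleR_right)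
  \<comment> \<open>Symmetry of \<open>\<xi>\<close> moves one factor across the inner product, so
    the norm of \<open>\<xi> x\<close> is the \<open>P\<close>-norm of \<open>x\<close> up to
    scaling.\<close>
  have norm_\<xi>: "(norm (\<xi> x))\<^sup>2 = inner (P x) x / d" for x
    using \<xi>(3)[of "\<xi> x" x, symmetric] by (simp add: power2_norm_eq_inner inner_eq_Re_cinner \<xi>(4) cinner.scaleR_left)
  have isometric: "norm (\<xi> (C i x)) = norm (\<xi> x)" if "i \<in> {1..k}" for i x
  proof -
    have "(norm (\<xi> (C i x)))\<^sup>2 = (norm (\<xi> x))\<^sup>2"
      by (simp add: norm_\<xi> inner_eq_Re_cinner invariant[OF that])
    then show ?thesis
      by simp
  qed
  have "norm ((\<xi> \<circ> C i \<circ> inv \<xi>) x) = norm x" if "i \<in> {1..k}" for i x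
    using isometric[OF that, of "inv \<xi> x"] invertible_op_inverse(3)[OF \<xi>(2)]
    by (simp add: fun_eq_iff)
  with commuting_tuple_conj[OF comm \<xi>(2)]
  have "commuting_isometries k (\<lambda>i. \<xi> \<circ> C i \<circ> inv \<xi>)"
    by (auto simp: commuting_isometries_def isometry_op_def commuting_tuple_def)
  with \<xi> show thesis
    using that by (simp add: M_def)
qed

theorem corollary4p3:
  fixes C :: "nat \<Rightarrow> 'h::chilbert_space \<Rightarrow> 'h" and k :: nat
  assumes separable: "\<exists>D :: 'h set. countable D \<and> closure D = UNIV"
    and commuting: "commuting_tuple k C"
  shows "((\<exists>V. commuting_isometries k V \<and> jointly_similar k C V) \<longleftrightarrow>
          (\<exists>c d :: real. 0 < c \<and> c \<le> d \<and>
            (\<forall>(s :: nat \<Rightarrow> nat) h.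
              c * (norm h)\<^sup>2 \<le> (norm (op_monomial C s k h))\<^sup>2 \<and>
              (norm (op_monomial C s k h))\<^sup>2 \<le> d * (norm h)\<^sup>2)))
       \<and> ((\<exists>V. commuting_isometries k V \<and> jointly_similar k C V) \<longrightarrow>
          (\<exists>\<xi>. invertible_op \<xi> \<and>
            \<xi> \<in> von_neumann_generated (insert id (C ` {1..k})) \<and>
            commuting_isometries k (\<lambda>i. \<xi> \<circ> C i \<circ> inv \<xi>)))"
    (is "(?similar \<longleftrightarrow> ?bounded) \<and> (?similar \<longrightarrow> ?conjugator)")
proof -
  \<comment> \<open>Three implications in a cycle yield the equivalence and the additional claim
    together.\<close>
  have "?similar \<Longrightarrow> ?bounded"
    using similar_to_isometries_imp_bounds by metis
  moreover have "?bounded \<Longrightarrow> ?conjugator"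
    using bounds_imp_similar_to_isometries[OF commuting] by metis
  moreover have "?conjugator \<Longrightarrow> ?similar"
  proof (elim exE conjE)
    fix \<xi> assume "invertible_op \<xi>" and V: "commuting_isometries k (\<lambda>i. \<xi> \<circ> C i \<circ> inv \<xi>)"
    note \<xi> = invertible_op_inverse[OF \<open>invertible_op \<xi>\<close>]
    \<comment> \<open>In \<open>jointly_similar\<close> the operator \<open>Y\<close> conjugates
      from \<open>V\<close> back to \<open>C\<close>, so the witness is
      \<open>inv \<xi>\<close>.\<close>
    have "C i = inv \<xi> \<circ> (\<xi> \<circ> C i \<circ> inv \<xi>) \<circ> inv (inv \<xi>)" for i
      using \<xi>(4) by (simp add: \<xi>(5) fun_eq_iff)
    then have "jointly_similar k C (\<lambda>i. \<xi> \<circ> C i \<circ> inv \<xi>)"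
      unfolding jointly_similar_def using \<xi>(1) by blast
    with V show ?similar
      by blast
  qed
  ultimately show ?thesis
    by blast
qed

end
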